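(* Let $T$ be the tonnetz graph: the simple bipartite graph whose vertices are the twelve major triads (white vertices) and the twelve minor triads (black vertices) in $\mathbb{Z}/12$, a major triad and a minor triad being joined by an edge if and only if they have exactly two pitch classes in common. Then $T$ is the Levi graph of a combinatorial configuration of type $\{12_3\}$, in which the points correspond to the twelve major triads (white vertices) and the lines to the twelve minor triads (black vertices). In particular $T$ has $36$ edges, each white vertex is joined to exactly three black vertices, and each black vertex is joined to exactly three white vertices; that is, $T$ is regular of degree three.
   Context: Pitch classes are identified with elements of $\mathbb{Z}/12$ ($C=0$, $C_\sharp=D_\flat=1,\dots,B=11$). For $x\in\mathbb{Z}/12$ the major triad with root $x$ is the set $\{x,x+4,x+7\}$ and the minor triad with root $x$ is the set $\{x,x+3,x+7\}$. An incidence structure consists of disjoint finite sets $\mathbb{P}$ (points) and $\mathbb{L}$ (lines) and an incidence relation $R:\mathbb{P}\times\mathbb{L}\to\{0,1\}$ ($p$ and $L$ are incident iff $R(p,L)=1$) such that two distinct lines are both incident with at most one common point and two distinct points are both incident with at most one common line. A combinatorial configuration of type $\{m_r,n_k\}$ is an incidence structure with $m$ points and $n$ lines such that every line is incident with exactly $k$ points and every point is incident with exactly $r$ lines; $\{n_k\}$ abbreviates $\{n_k,n_k\}$. The Levi graph of a combinatorial configuration is the bipartite graph with one white vertex for each point and one black vertex for each line, a white vertex and a black vertex being joined by an edge exactly when the corresponding point and line are incident. *)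

theory Defs
  imports "HOL-Library.Numeral_Type"
begin

type_synonym pitch_class = "12"

definition major_triad :: "pitch_class \<Rightarrow> pitch_class set" where
  "major_triad x = {x, x + 4, x + 7}"

definition minor_triad :: "pitch_class \<Rightarrow> pitch_class set" where
  "minor_triad x = {x, x + 3, x + 7}"

definition major_triads :: "pitch_class set set" where
  "major_triads = range major_triad"

definition minor_triads :: "pitch_class set set" where
  "minor_triads = range minor_triad"

text \<open>Points and lines live in one type so that their disjointness is a genuine condition.
  Only the values of \<open>R\<close> on \<open>P \<times> L\<close> matter.\<close>

definition incidence_structure :: "'v set \<Rightarrow> 'v set \<Rightarrow> ('v \<Rightarrow> 'v \<Rightarrow> bool) \<Rightarrow> bool" where
  "incidence_structure P L R \<longleftrightarrow>
     finite P \<and> finite L \<and> P \<inter> L = {} \<and>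
     (\<forall>l\<in>L. \<forall>l'\<in>L. l \<noteq> l' \<longrightarrow> card {p \<in> P. R p l \<and> R p l'} \<le> 1) \<and>
     (\<forall>p\<in>P. \<forall>p'\<in>P. p \<noteq> p' \<longrightarrow> card {l \<in> L. R p l \<and> R p' l} \<le> 1)"

text \<open>\<open>configuration m r n k\<close> is the type \<open>{m\<^sub>r, n\<^sub>k}\<close>.\<close>

definition configuration ::
    "nat \<Rightarrow> nat \<Rightarrow> nat \<Rightarrow> nat \<Rightarrow> 'v set \<Rightarrow> 'v set \<Rightarrow> ('v \<Rightarrow> 'v \<Rightarrow> bool) \<Rightarrow> bool" where
  "configuration m r n k P L R \<longleftrightarrow>
     incidence_structure P L R \<and> card P = m \<and> card L = n \<and>
     (\<forall>l\<in>L. card {p \<in> P. R p l} = k) \<and>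
     (\<forall>p\<in>P. card {l \<in> L. R p l} = r)"

abbreviation balanced_configuration ::
    "nat \<Rightarrow> nat \<Rightarrow> 'v set \<Rightarrow> 'v set \<Rightarrow> ('v \<Rightarrow> 'v \<Rightarrow> bool) \<Rightarrow> bool" where
  "balanced_configuration n k \<equiv> configuration n k n k"

text \<open>Undirected graphs with a black/white colouring of the vertices; an edge is the set of its
  two endpoints.\<close>

record 'v bicoloured_graph =
  white :: "'v set"
  black :: "'v set"
  edges :: "'v set set"

definition simple_bipartite_graph :: "'v bicoloured_graph \<Rightarrow> bool" where
  "simple_bipartite_graph G \<longleftrightarrow>
     white G \<inter> black G = {} \<and>
     (\<forall>e\<in>edges G. \<exists>w\<in>white G. \<exists>b\<in>black G. e = {w, b})"

definition degree :: "'v bicoloured_graph \<Rightarrow> 'v \<Rightarrow> nat" where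
  "degree G v = card {e \<in> edges G. v \<in> e}"

definition regular :: "'v bicoloured_graph \<Rightarrow> nat \<Rightarrow> bool" where
  "regular G d \<longleftrightarrow> (\<forall>v \<in> white G \<union> black G. degree G v = d)"

definition levi_graph :: "'v set \<Rightarrow> 'v set \<Rightarrow> ('v \<Rightarrow> 'v \<Rightarrow> bool) \<Rightarrow> 'v bicoloured_graph" where
  "levi_graph P L R =
     \<lparr>white = P, black = L, edges = {{p, l} | p l. p \<in> P \<and> l \<in> L \<and> R p l}\<rparr>"

definition tonnetz :: "pitch_class set bicoloured_graph" where
  "tonnetz =
     \<lparr>white = major_triads, black = minor_triads,
      edges = {{M, N} | M N. M \<in> major_triads \<and> N \<in> minor_triads \<and> card (M \<inter> N) = 2}\<rparr>"

end

theory Submission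
  imports Defs
begin

text \<open>Transposition acts on triads by translation of roots, so the number of tones common to
  \<open>major_triad x\<close> and \<open>minor_triad y\<close> depends only on
  \<open>y - x\<close>. A check of twelve cases (\<open>card_triads_zero_Int_eq_2_iff\<close>) shows
  that it is 2 exactly for the differences 0, 4, 9. Three differences give three neighbours on
  either side. Since a nonzero difference of two elements of {0, 4, 9} determines both, there is no
  4-cycle (\<open>tonnetz_no_4_cycle\<close>), and this is the incidence axiom. Edge count and
  regularity then follow from general facts on Levi graphs.\<close>

lemma levi_graph_sel [simp]:
  "white (levi_graph P L R) = P"
  "black (levi_graph P L R) = L"
  "edges (levi_graph P L R) = {{p, l} | p l. p \<in> P \<and> l \<in> L \<and> R p l}"
  by (simp_all add: levi_graph_def)

lemma levi_graph_edge_iff: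
  assumes "P \<inter> L = {}" "p \<in> P" "l \<in> L"
  shows "{p, l} \<in> edges (levi_graph P L R) \<longleftrightarrow> R p l"
  using assms by (auto simp: doubleton_eq_iff)

lemma simple_bipartite_levi_graph:
  assumes "P \<inter> L = {}"
  shows "simple_bipartite_graph (levi_graph P L R)"
  using assms by (auto simp: simple_bipartite_graph_def)

lemma degree_levi_graph_white:
  assumes "P \<inter> L = {}" "p \<in> P"
  shows "degree (levi_graph P L R) p = card {l \<in> L. R p l}"
proof -
  have "{e \<in> edges (levi_graph P L R). p \<in> e} = (\<lambda>l. {p, l}) ` {l \<in> L. R p l}"
    using assms by auto
  moreover have "inj_on (\<lambda>l. {p, l}) {l \<in> L. R p l}"
    by (auto simp: inj_on_def doubleton_eq_iff)
  ultimately show ?thesis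
    by (simp add: degree_def card_image)
qed

lemma degree_levi_graph_black:
  assumes "P \<inter> L = {}" "l \<in> L"
  shows "degree (levi_graph P L R) l = card {p \<in> P. R p l}"
proof -
  have "{e \<in> edges (levi_graph P L R). l \<in> e} = (\<lambda>p. {p, l}) ` {p \<in> P. R p l}"
    using assms by auto
  moreover have "inj_on (\<lambda>p. {p, l}) {p \<in> P. R p l}"
    by (auto simp: inj_on_def doubleton_eq_iff)
  ultimately show ?thesis
    by (simp add: degree_def card_image)
qed

text \<open>Double counting: each edge has exactly one endpoint in \<open>P\<close>, so summing over
  points counts it once.\<close>

lemma card_edges_levi_graph:
  assumes "finite P" "finite L" "P \<inter> L = {}"
  shows "card (edges (levi_graph P L R)) = (\<Sum>p\<in>P. card {l \<in> L. R p l})"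
proof -
  let ?S = "SIGMA p:P. {l \<in> L. R p l}"
  have "edges (levi_graph P L R) = (\<lambda>(p, l). {p, l}) ` ?S"
    by auto
  moreover have "inj_on (\<lambda>(p, l). {p, l}) ?S"
    \<comment> \<open>Disjointness excludes that \<open>{p, l}\<close> and \<open>{p', l'}\<close>
      agree with the roles of point and line swapped.\<close>
    using assms(3) by (auto simp: inj_on_def doubleton_eq_iff)
  ultimately show ?thesis
    using assms by (simp add: card_image)
qed

lemma UNIV_pitch_class: "(UNIV :: pitch_class set) = {0,1,2,3,4,5,6,7,8,9,10,11}"
proof -
  have "card {0::pitch_class,1,2,3,4,5,6,7,8,9,10,11} = CARD(pitch_class)"
    by simp
  then show ?thesis
    by (intro card_subset_eq[symmetric]) auto
qed

lemma pitch_class_exhaust: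
  fixes d :: pitch_class
  obtains "d = 0" | "d = 1" | "d = 2" | "d = 3" | "d = 4" | "d = 5"
    | "d = 6" | "d = 7" | "d = 8" | "d = 9" | "d = 10" | "d = 11"
proof -
  have "d \<in> {0,1,2,3,4,5,6,7,8,9,10,11}"
    using UNIV_pitch_class by blast
  then show thesis
    using that by blast
qed

text \<open>With its minor counterpart, this reduces every question about two triads to the case
  where one root is 0, leaving twelve cases instead of 144.\<close>

lemma major_triad_translate: "major_triad (x + y) = (+) x ` major_triad y"
  by (simp add: major_triad_def ac_simps)

lemma minor_triad_translate: "minor_triad (x + y) = (+) x ` minor_triad y"
  by (simp add: minor_triad_def ac_simps)

lemma major_triad_eq_zero_iff: "major_triad 0 = major_triad d \<longleftrightarrow> d = 0"
  by (rule pitch_class_exhaust[of d]) (simp_all add: major_triad_def set_eq_subset)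

lemma minor_triad_eq_zero_iff: "minor_triad 0 = minor_triad d \<longleftrightarrow> d = 0"
  by (rule pitch_class_exhaust[of d]) (simp_all add: minor_triad_def set_eq_subset)

lemma major_triad_zero_neq_minor_triad: "major_triad 0 \<noteq> minor_triad d"
  by (rule pitch_class_exhaust[of d])
    (simp_all add: major_triad_def minor_triad_def set_eq_subset)

text \<open>For C major the neighbours are its parallel (C minor, 0), its leading-tone exchange (E
  minor, 4) and its relative (A minor, 9).\<close>

lemma card_triads_zero_Int_eq_2_iff:
  "card (major_triad 0 \<inter> minor_triad d) = 2 \<longleftrightarrow> d \<in> {0, 4, 9}"
  by (rule pitch_class_exhaust[of d]) (simp_all add: major_triad_def minor_triad_def)

lemma major_triad_eq_iff [simp]: "major_triad x = major_triad y \<longleftrightarrow> x = y"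
  \<comment> \<open>Both triads become images under the injective map \<open>(+) x\<close>, as
    \<open>y = x + (y - x)\<close>.\<close>
  using major_triad_translate[of x 0] major_triad_translate[of x "y - x"]
  by (auto simp: inj_image_eq_iff major_triad_eq_zero_iff)

lemma minor_triad_eq_iff [simp]: "minor_triad x = minor_triad y \<longleftrightarrow> x = y"
  using minor_triad_translate[of x 0] minor_triad_translate[of x "y - x"]
  by (auto simp: inj_image_eq_iff minor_triad_eq_zero_iff)

lemma major_triad_neq_minor_triad: "major_triad x \<noteq> minor_triad y"
  using major_triad_translate[of x 0] minor_triad_translate[of x "y - x"]
  by (auto simp: inj_image_eq_iff major_triad_zero_neq_minor_triad)

lemma card_triads_Int_eq_2_iff:
  "card (major_triad x \<inter> minor_triad y) = 2 \<longleftrightarrow> y - x \<in> {0, 4, 9}"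
proof -
  have "major_triad x \<inter> minor_triad y = (+) x ` (major_triad 0 \<inter> minor_triad (y - x))"
    using major_triad_translate[of x 0] minor_triad_translate[of x "y - x"]
    by (simp add: image_Int)
  then show ?thesis
    by (simp add: card_image card_triads_zero_Int_eq_2_iff)
qed

text \<open>The six differences of distinct elements of \<open>{0, 4, 9}\<close> modulo 12 are distinct, so a nonzero
  difference determines both elements: this is what rules out 4-cycles.\<close>

lemma difference_set_0_4_9:
  fixes a b c d :: pitch_class
  assumes "a \<in> {0, 4, 9}" "b \<in> {0, 4, 9}" "c \<in> {0, 4, 9}" "d \<in> {0, 4, 9}"
    and "a - b = c - d" "a \<noteq> b"
  shows "a = c"
  using assms by auto

lemma card_minor_triads_adjacent:
  assumes "M \<in> major_triads"
  shows "card {N \<in> minor_triads. card (M \<inter> N) = 2} = 3"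
proof -
  obtain x where M: "M = major_triad x"
    using assms by (auto simp: major_triads_def)
  have "{N \<in> minor_triads. card (M \<inter> N) = 2} = minor_triad ` {y. y - x \<in> {0, 4, 9}}"
    unfolding minor_triads_def M card_triads_Int_eq_2_iff[symmetric] by blast
  moreover have "card {y. y - x \<in> {0, 4, 9}} = card ({0, 4, 9} :: pitch_class set)"
    by (rule bij_betw_same_card[where f = "\<lambda>y. y - x"],
        rule bij_betw_byWitness[where f' = "\<lambda>d. x + d"]) auto
  ultimately show ?thesis
    by (simp add: card_image inj_on_def)
qed

lemma card_major_triads_adjacent:
  assumes "N \<in> minor_triads"
  shows "card {M \<in> major_triads. card (M \<inter> N) = 2} = 3"
proof -
  obtain y where N: "N = minor_triad y"
    using assms by (auto simp: minor_triads_def)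
  have "{M \<in> major_triads. card (M \<inter> N) = 2} = major_triad ` {x. y - x \<in> {0, 4, 9}}"
    unfolding major_triads_def N card_triads_Int_eq_2_iff[symmetric] by blast
  moreover have "card {x. y - x \<in> {0, 4, 9}} = card ({0, 4, 9} :: pitch_class set)"
    by (rule bij_betw_same_card[where f = "\<lambda>x. y - x"],
        rule bij_betw_byWitness[where f' = "\<lambda>d. y - d"]) auto
  ultimately show ?thesis
    by (simp add: card_image inj_on_def)
qed

lemma triads_disjoint: "major_triads \<inter> minor_triads = {}"
  by (auto simp: major_triads_def minor_triads_def major_triad_neq_minor_triad)

text \<open>Symmetric in points and lines, so it yields both uniqueness conditions of an incidence
  structure.\<close>

lemma tonnetz_no_4_cycle:
  assumes "M \<in> major_triads" "M' \<in> major_triads" "N \<in> minor_triads" "N' \<in> minor_triads"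
    and "card (M \<inter> N) = 2" "card (M \<inter> N') = 2" "card (M' \<inter> N) = 2" "card (M' \<inter> N') = 2"
  shows "M = M' \<or> N = N'"
proof -
  obtain x x' y y' where
    "M = major_triad x" "M' = major_triad x'" "N = minor_triad y" "N' = minor_triad y'"
    using assms(1-4) unfolding major_triads_def minor_triads_def by blast
  then show ?thesis
    \<comment> \<open>Both differences equal \<open>y - y'\<close>; if this is nonzero,
      \<open>y - x = y - x'\<close>, whence \<open>x = x'\<close>.\<close>
    using difference_set_0_4_9[of "y - x" "y' - x" "y - x'" "y' - x'"] assms(5-8)
    by (simp only: card_triads_Int_eq_2_iff) auto
qed

lemma tonnetz_incidence_structure:
  "incidence_structure major_triads minor_triads (\<lambda>M N. card (M \<inter> N) = 2)"
  using tonnetz_no_4_cycle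
  unfolding incidence_structure_def One_nat_def
  \<comment> \<open>For a finite set, having at most one element means that any two elements are
    equal, which is the form of the 4-cycle lemma.\<close>
  by (simp add: triads_disjoint card_le_Suc0_iff_eq) blast

lemma tonnetz_configuration:
  "balanced_configuration 12 3 major_triads minor_triads (\<lambda>M N. card (M \<inter> N) = 2)"
proof -
  have "card major_triads = 12" "card minor_triads = 12"
    by (simp_all add: major_triads_def minor_triads_def card_image inj_on_def)
  then show ?thesis
    by (simp add: configuration_def tonnetz_incidence_structure
        card_minor_triads_adjacent card_major_triads_adjacent)
qed

lemma tonnetz_levi_graph:
  "tonnetz = levi_graph major_triads minor_triads (\<lambda>M N. card (M \<inter> N) = 2)"
  by (simp add: tonnetz_def levi_graph_def)

theorem proposition1:
  shows "simple_bipartite_graph tonnetz \<and>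
    (\<exists>R. balanced_configuration 12 3 major_triads minor_triads R \<and>
         tonnetz = levi_graph major_triads minor_triads R) \<and>
    card (edges tonnetz) = 36 \<and>
    (\<forall>w \<in> white tonnetz. card {b \<in> black tonnetz. {w, b} \<in> edges tonnetz} = 3) \<and>
    (\<forall>b \<in> black tonnetz. card {w \<in> white tonnetz. {w, b} \<in> edges tonnetz} = 3) \<and>
    regular tonnetz 3"
proof (intro conjI)
  show "\<exists>R. balanced_configuration 12 3 major_triads minor_triads R \<and>
      tonnetz = levi_graph major_triads minor_triads R"
    using tonnetz_configuration tonnetz_levi_graph by blast
next
  let ?R = "\<lambda>M N :: pitch_class set. card (M \<inter> N) = 2"
  note sel = tonnetz_levi_graph levi_graph_sel(1,2)
  show "simple_bipartite_graph tonnetz"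
    by (simp add: tonnetz_levi_graph simple_bipartite_levi_graph triads_disjoint)
  have "card (edges tonnetz) = (\<Sum>M\<in>major_triads. card {N \<in> minor_triads. ?R M N})"
    unfolding tonnetz_levi_graph
    by (intro card_edges_levi_graph finite triads_disjoint)
  also have "\<dots> = card major_triads * 3"
    using card_minor_triads_adjacent by simp
  also have "\<dots> = 36"
    using tonnetz_configuration by (simp add: configuration_def)
  finally show "card (edges tonnetz) = 36" .
  show "\<forall>w \<in> white tonnetz. card {b \<in> black tonnetz. {w, b} \<in> edges tonnetz} = 3"
    unfolding sel using card_minor_triads_adjacent
    \<comment> \<open>The edge set must stay folded for \<open>levi_graph_edge_iff\<close> to apply;
      \<open>conj_cong\<close> supplies the membership of \<open>b\<close> that it requires.\<close>
    by (simp add: levi_graph_edge_iff[OF triads_disjoint] cong: conj_cong del: levi_graph_sel(3))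
  show "\<forall>b \<in> black tonnetz. card {w \<in> white tonnetz. {w, b} \<in> edges tonnetz} = 3"
    unfolding sel using card_major_triads_adjacent
    by (simp add: levi_graph_edge_iff[OF triads_disjoint] cong: conj_cong del: levi_graph_sel(3))
  show "regular tonnetz 3"
    unfolding regular_def sel using card_minor_triads_adjacent card_major_triads_adjacent
    by (auto simp: degree_levi_graph_white degree_levi_graph_black triads_disjoint)
qed

end
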